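(* Let $f\in\mathcal{A}$, $f(z)=z+\sum_{n=2}^{\infty}a_nz^n$. If for every $\theta\in[0,2\pi)$ $$\sum_{n=2}^{\infty}\left|\frac{n-\left(1+\sinh(e^{i\theta})\right)}{\sinh(e^{i\theta})}\right||a_n|<1,$$ then $f\in\mathcal{G}_{sh}$.
   Context: $\mathbb{D}=\{z\in\mathbb{C}:|z|<1\}$. $\mathcal{A}$ is the class of analytic functions on $\mathbb{D}$ of the form $f(z)=z+\sum_{n=2}^\infty a_nz^n$. Subordination: $f_1\prec f_2$ means there is a Schwarz function $\omega$ (analytic on $\mathbb{D}$, $|\omega(z)|\le|z|$) with $f_1(z)=f_2(\omega(z))$ for $z\in\mathbb{D}$. The class $\mathcal{G}_{sh}$ is $$\mathcal{G}_{sh}=\left\{f\in\mathcal{A}:\frac{zf'(z)}{f(z)}-1\prec\sinh(z)\right\}.$$ *)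

theory Defs
  imports "HOL-Complex_Analysis.Complex_Analysis"
begin

abbreviation unit_disc :: "complex set" where
  "unit_disc \<equiv> ball 0 1"

text \<open>The coefficients \<open>a 0\<close> and \<open>a 1\<close> play no role: the expansion is
  \<open>f z = z + (\<Sum>n\<ge>2. a n * z ^ n)\<close>.\<close>

definition normalized_expansion :: "(complex \<Rightarrow> complex) \<Rightarrow> (nat \<Rightarrow> complex) \<Rightarrow> bool" where
  "normalized_expansion f a \<longleftrightarrow>
     (\<forall>z\<in>unit_disc. (\<lambda>n. a (n + 2) * z ^ (n + 2)) sums (f z - z))"

definition class_A :: "(complex \<Rightarrow> complex) set" where
  "class_A = {f. f analytic_on unit_disc \<and> (\<exists>a. normalized_expansion f a)}"

definition schwarz_function :: "(complex \<Rightarrow> complex) \<Rightarrow> bool" where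
  "schwarz_function \<omega> \<longleftrightarrow>
     \<omega> analytic_on unit_disc \<and> (\<forall>z\<in>unit_disc. norm (\<omega> z) \<le> norm z)"

definition subordinate :: "(complex \<Rightarrow> complex) \<Rightarrow> (complex \<Rightarrow> complex) \<Rightarrow> bool"
    (infix \<open>\<prec>\<^sub>D\<close> 50) where
  "f \<prec>\<^sub>D g \<longleftrightarrow> (\<exists>\<omega>. schwarz_function \<omega> \<and> (\<forall>z\<in>unit_disc. f z = g (\<omega> z)))"

text \<open>The quotient \<open>z * f' z / f z\<close> has a removable singularity at the origin, where its
  limit is 1 for \<open>f\<close> in \<^const>\<open>class_A\<close>; division by zero in HOL would give 0 there.\<close>

definition starlike_quotient :: "(complex \<Rightarrow> complex) \<Rightarrow> complex \<Rightarrow> complex" where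
  "starlike_quotient f z = (if z = 0 then 1 else z * deriv f z / f z)"

text \<open>Membership presupposes that the quotient is defined on the whole disc, so that \<open>f\<close>
  vanishes only at the origin. This is stated explicitly, since division by zero is total
  in HOL.\<close>

definition G_sh :: "(complex \<Rightarrow> complex) set" where
  "G_sh = {f \<in> class_A.
     (\<forall>z\<in>unit_disc - {0}. f z \<noteq> 0) \<and>
     (\<lambda>z. starlike_quotient f z - 1) \<prec>\<^sub>D sinh}"

lemma starlike_quotient_tendsto:
  assumes "f \<in> class_A"
  shows "starlike_quotient f \<midarrow>0\<rightarrow> starlike_quotient f 0"
proof -
  from assms obtain a where hol: "f holomorphic_on unit_disc"
    and a: "\<And>z. z \<in> unit_disc \<Longrightarrow> (\<lambda>n. a (n + 2) * z ^ (n + 2)) sums (f z - z)"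
    unfolding class_A_def normalized_expansion_def using analytic_imp_holomorphic by blast
  define b where "b n = (if n = 0 then 0 else if n = 1 then 1 else a n)" for n
  have b: "(\<lambda>n. b n * (z - 0) ^ n) sums f z" if "z \<in> unit_disc" for z
  proof -
    have "(\<lambda>n. b (n + 2) * z ^ (n + 2)) sums (f z - (\<Sum>n<2. b n * z ^ n))"
      using a[OF that] by (simp add: b_def numeral_2_eq_2)
    then show ?thesis
      by (subst (asm) sums_iff_shift) simp
  qed
  have f0: "f 0 = 0"
    using a[of 0] by (simp add: sums_iff)
  have "((\<lambda>z. \<Sum>n. b n * z ^ n) has_field_derivative (\<Sum>n. diffs b n * 0 ^ n)) (at 0)"
    by (rule termdiffs_strong'[where K = 1]) (use b in \<open>auto simp: sums_iff\<close>)
  moreover have "(\<Sum>n. diffs b n * 0 ^ n) = 1"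
    by (simp add: diffs_def b_def)
  moreover have "(\<Sum>n. b n * z ^ n) = f z" if "z \<in> unit_disc" for z
    using b[OF that] by (simp add: sums_iff)
  ultimately have D: "(f has_field_derivative 1) (at 0)"
    using has_field_derivative_transform_within_open[of _ 1 0 unit_disc f] by force
  then have deriv0: "deriv f 0 = 1"
    by (rule DERIV_imp_deriv)
  from D have q: "(\<lambda>z. f z / z) \<midarrow>0\<rightarrow> 1"
    by (simp add: has_field_derivative_iff f0)
  have "deriv f holomorphic_on unit_disc"
    using hol by (intro holomorphic_deriv) auto
  then have "isCont (deriv f) 0"
    using holomorphic_on_imp_continuous_on continuous_on_interior by fastforce
  then have d: "deriv f \<midarrow>0\<rightarrow> 1"
    using deriv0 by (simp add: isCont_def)
  have "(\<lambda>z. deriv f z / (f z / z)) \<midarrow>0\<rightarrow> 1 / 1"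
    by (intro tendsto_divide d q) auto
  moreover have "\<forall>\<^sub>F z in at 0. deriv f z / (f z / z) = starlike_quotient f z"
    by (auto simp: eventually_at_filter starlike_quotient_def)
  ultimately show ?thesis
    by (simp add: starlike_quotient_def Lim_transform_eventually)
qed

end

theory Submission
  imports Defs
begin

text \<open>For \<open>s = sinh \<zeta>\<close> with \<open>\<bar>\<zeta>\<bar> = 1\<close>, the function \<open>z f'(z) - (1 + s) f(z)\<close> has linear term
  \<open>-s z\<close>, and the coefficient condition says that this term dominates the rest of the
  series; hence \<open>q(z) = z f'(z) / f(z) - 1\<close> omits the curve \<open>sinh (\<partial>D)\<close>. That curve contains
  the boundary of \<open>sinh(D)\<close>, so by connectedness \<open>q\<close> maps \<open>D\<close> into \<open>sinh(D)\<close>. As \<open>sinh\<close> is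
  injective on \<open>D\<close>, the Schwarz lemma applies to \<open>sinh\<^sup>-\<^sup>1 \<circ> q\<close>.\<close>

text \<open>Equal values of \<open>sinh\<close> force \<open>w - z\<close> to be an even, or
  \<open>w + z\<close> an odd, multiple of \<open>pi * \<i>\<close>. In the strip both imaginary
  parts stay below \<open>pi\<close> in modulus, so only the zero multiple survives.\<close>

lemma sinh_eq_imp_eq:
  fixes w z :: complex
  assumes "\<bar>Im w\<bar> < pi / 2" "\<bar>Im z\<bar> < pi / 2" "sinh w = sinh z"
  shows "w = z"
proof -
  have *: "pi \<le> \<bar>of_int k * pi\<bar>" if "k \<noteq> 0" for k :: int
    using that mult_right_mono[of 1 "\<bar>real_of_int k\<bar>" pi] by (simp add: abs_mult)
  obtain x where "x \<in> \<int>" and x: "w = z - 2 * \<i> * of_real x * of_real pi \<or>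
      w = - (2 * complex_of_real x + 1) * \<i> * of_real pi - z"
    using assms(3) unfolding sinh_complex_eq_iff by blast
  then obtain n :: int where "w = z - 2 * \<i> * of_real (of_int n) * of_real pi \<or>
      w = - (2 * complex_of_real (of_int n) + 1) * \<i> * of_real pi - z"
    by (auto simp only: elim!: Ints_cases)
  then show ?thesis
  proof
    assume w: "w = z - 2 * \<i> * of_real (of_int n) * of_real pi"
    then have "Im w = Im z - of_int (2 * n) * pi"
      by simp
    then have "n = 0"
      using *[of "2 * n"] assms(1,2) by linarith
    then show ?thesis
      using w by simp
  next
    assume "w = - (2 * complex_of_real (of_int n) + 1) * \<i> * of_real pi - z"
    then have "Im w = - of_int (2 * n + 1) * pi - Im z"
      by simp
    moreover have "2 * n + 1 \<noteq> 0"
      by presburger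
    ultimately show ?thesis
      using *[of "2 * n + 1"] assms(1,2) by linarith
  qed
qed

text \<open>The disc lies in that strip because \<open>1 < pi / 2\<close>. Including the circle also
  yields \<open>sinh \<zeta> \<noteq> 0\<close> there, by comparison with
  \<open>sinh 0 = 0\<close>.\<close>

lemma inj_on_sinh_cball: "inj_on sinh (cball (0::complex) 1)"
proof (rule inj_onI)
  fix w z :: complex
  assume "w \<in> cball 0 1" "z \<in> cball 0 1" "sinh w = sinh z"
  moreover from this have "\<bar>Im w\<bar> \<le> 1" "\<bar>Im z\<bar> \<le> 1"
    using abs_Im_le_cmod[of w] abs_Im_le_cmod[of z] by auto
  ultimately show "w = z"
    using pi_gt3 by (intro sinh_eq_imp_eq[OF _ _ \<open>sinh w = sinh z\<close>]) linarith+
qed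

text \<open>By compactness the closure of \<open>g\<close> unit_disc\<open>stays inside\<close>g
  \<open>cball 0 1\<close>, so its frontier consists of values of \<open>g\<close> on the circle,
  which \<open>p\<close> omits. A connected set that meets an open set but not its frontier lies
  inside it.\<close>

lemma subordinateI_omits_boundary:
  assumes p: "p holomorphic_on unit_disc"
    and g: "g holomorphic_on unit_disc" "continuous_on (cball 0 1) g" "inj_on g unit_disc"
    and p0: "p 0 = g 0"
    and omits: "\<And>z \<zeta>. z \<in> unit_disc \<Longrightarrow> \<zeta> \<in> sphere 0 1 \<Longrightarrow> p z \<noteq> g \<zeta>"
  shows "p \<prec>\<^sub>D g"
proof -
  have op: "open (g ` unit_disc)"
    using g by (intro open_mapping_thm3) auto
  have "closed (g ` cball 0 1)"
    using g(2) compact_cball by (intro compact_imp_closed compact_continuous_image)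
  then have "closure (g ` unit_disc) \<subseteq> g ` cball 0 1"
    by (intro closure_minimal image_mono) auto
  then have "frontier (g ` unit_disc) \<subseteq> g ` cball 0 1 - g ` unit_disc"
    using op by (auto simp: frontier_def interior_open)
  also have "\<dots> \<subseteq> g ` sphere 0 1"
    unfolding cball_diff_eq_sphere[symmetric] by blast
  finally have fr: "p ` unit_disc \<inter> frontier (g ` unit_disc) = {}"
    using omits by fast
  have "connected (p ` unit_disc)"
    using p by (intro connected_continuous_image holomorphic_on_imp_continuous_on) auto
  moreover have "p 0 \<in> p ` unit_disc \<inter> g ` unit_disc"
    using imageI[of 0 unit_disc p] imageI[of 0 unit_disc g] p0 by simp
  ultimately have sub: "p ` unit_disc \<subseteq> g ` unit_disc"
    using fr connected_Int_frontier[of "p ` unit_disc" "g ` unit_disc"] by blast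
  obtain h where h: "h holomorphic_on g ` unit_disc"
    "\<And>z. z \<in> unit_disc \<Longrightarrow> h (g z) = z"
    by (rule holomorphic_has_inverse[OF g(1) open_ball g(3)]) (rule that, assumption, simp)
  have gh: "h (p z) \<in> unit_disc \<and> g (h (p z)) = p z" if z: "z \<in> unit_disc" for z
  proof -
    obtain w where "w \<in> unit_disc" "p z = g w"
      using subsetD[OF sub imageI[OF z]] by (rule imageE)
    then show ?thesis
      using h(2)[of w] by simp
  qed
  have hol: "(\<lambda>z. h (p z)) holomorphic_on unit_disc"
    using holomorphic_on_compose_gen[OF p h(1) sub] by (simp add: o_def)
  have "norm (h (p z)) \<le> norm z" if "z \<in> unit_disc" for z
  proof (rule Schwarz_Lemma(1)[OF hol])
    show "h (p 0) = 0"
      using h(2)[of 0] p0 by simp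
  qed (use gh that in auto)
  then have "schwarz_function (\<lambda>z. h (p z))"
    using hol by (simp add: schwarz_function_def analytic_on_open)
  then show ?thesis
    unfolding subordinate_def using gh by (intro exI[of _ "\<lambda>z. h (p z)"]) simp
qed

lemma normalized_expansion_deriv:
  assumes a: "normalized_expansion f a" and z: "z \<in> unit_disc"
  shows "(\<lambda>n. of_nat (n + 2) * a (n + 2) * z ^ (n + 2)) sums (z * deriv f z - z)"
proof -
  \<comment> \<open>The expansion leaves \<open>a 0\<close> and \<open>a 1\<close> unconstrained;
    \<open>b\<close> holds the actual Taylor coefficients of \<open>f\<close>, so termwise
    differentiation applies to a full power series.\<close>
  define b where "b n = (if n = 0 then 0 else if n = 1 then 1 else a n)" for n
  have b: "(\<lambda>n. b n * w ^ n) sums f w" if "w \<in> unit_disc" for w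
  proof -
    have "(\<lambda>n. b (n + 2) * w ^ (n + 2)) sums (f w - (\<Sum>n<2. b n * w ^ n))"
      using a that by (simp add: b_def numeral_2_eq_2 normalized_expansion_def)
    then show ?thesis
      by (subst (asm) sums_iff_shift) simp
  qed
  have sm: "summable (\<lambda>n. b n * w ^ n)" if "norm w < 1" for w
    using b[of w] that by (simp add: sums_iff)
  have "((\<lambda>z. \<Sum>n. b n * z ^ n) has_field_derivative (\<Sum>n. diffs b n * z ^ n)) (at z)"
    using z by (intro termdiffs_strong'[where K = 1] sm) auto
  moreover have "(\<Sum>n. b n * w ^ n) = f w" if "w \<in> unit_disc" for w
    using b[OF that] by (simp add: sums_iff)
  ultimately have "(f has_field_derivative (\<Sum>n. diffs b n * z ^ n)) (at z)"
    using has_field_derivative_transform_within_open[of _ _ z unit_disc f] z by force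
  then have D: "deriv f z = (\<Sum>n. diffs b n * z ^ n)"
    by (rule DERIV_imp_deriv)
  have "summable (\<lambda>n. diffs b n * z ^ n)"
    using z by (intro termdiff_converges[where K = 1] sm) auto
  then have "(\<lambda>n. z * (diffs b n * z ^ n)) sums (z * deriv f z)"
    unfolding D by (intro sums_mult summable_sums)
  then have "(\<lambda>n. of_nat (Suc n) * b (Suc n) * z ^ Suc n) sums (z * deriv f z)"
    by (simp add: diffs_def mult_ac)
  \<comment> \<open>The shift splits off the first term, \<open>1 * b 1 * z = z\<close>.\<close>
  then have "(\<lambda>n. of_nat (Suc (Suc n)) * b (Suc (Suc n)) * z ^ Suc (Suc n))
      sums (z * deriv f z - z)"
    by (subst sums_Suc_iff) (simp add: b_def)
  then show ?thesis
    by (simp add: b_def)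
qed

text \<open>Since \<open>norm z ^ (n + 2) \<le> norm z\<close>, the tail is at most
  \<open>norm z * (\<Sum>n. norm (c n))\<close>, strictly below \<open>norm (l * z)\<close>, so it
  cannot cancel the linear term. This serves both for \<open>f\<close> itself and for
  \<open>z f' - (1 + s) f\<close>.\<close>

lemma dominated_power_series_nonzero:
  fixes c :: "nat \<Rightarrow> complex"
  assumes "summable (\<lambda>n. norm (c n))" "(\<Sum>n. norm (c n)) < norm l"
    and z: "z \<in> unit_disc" "z \<noteq> 0"
    and S: "(\<lambda>n. c n * z ^ (n + 2)) sums (S - l * z)"
  shows "S \<noteq> 0"
proof
  assume "S = 0"
  have le: "norm (c n * z ^ (n + 2)) \<le> norm z * norm (c n)" for n
  proof -
    have "norm z ^ Suc n \<le> 1"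
      using z by (intro power_le_one) auto
    then have "norm (c n) * norm z * norm z ^ Suc n \<le> norm (c n) * norm z * 1"
      by (intro mult_left_mono) auto
    then show ?thesis
      by (simp add: norm_mult norm_power mult_ac)
  qed
  have "norm (S - l * z) \<le> (\<Sum>n. norm z * norm (c n))"
    unfolding sums_unique[OF S] by (intro norm_suminf_le[OF le] summable_mult assms(1))
  also have "\<dots> = norm z * (\<Sum>n. norm (c n))"
    using assms(1) by (rule suminf_mult)
  also have "\<dots> < norm z * norm l"
    using assms(2) z(2) by simp
  finally show False
    using \<open>S = 0\<close> by (simp add: norm_mult mult.commute)
qed

theorem theorem4:
  fixes f :: "complex \<Rightarrow> complex" and a :: "nat \<Rightarrow> complex"
  assumes "f \<in> class_A"
    and "normalized_expansion f a"
    and "\<And>\<theta>::real. \<theta> \<in> {0..<2 * pi} \<Longrightarrow>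
           summable (\<lambda>n. norm ((of_nat (n + 2) - (1 + sinh (exp (\<i> * of_real \<theta>))))
                               / sinh (exp (\<i> * of_real \<theta>))) * norm (a (n + 2))) \<and>
           (\<Sum>n. norm ((of_nat (n + 2) - (1 + sinh (exp (\<i> * of_real \<theta>))))
                               / sinh (exp (\<i> * of_real \<theta>))) * norm (a (n + 2))) < 1"
  shows "f \<in> G_sh"
proof -
  let ?c = "\<lambda>\<zeta> n. (of_nat (n + 2) - (1 + sinh \<zeta>)) * a (n + 2)"
  have sinh_nz: "sinh \<zeta> \<noteq> 0" if "norm \<zeta> = 1" for \<zeta> :: complex
    using that inj_onD[OF inj_on_sinh_cball, of \<zeta> 0] by auto
  \<comment> \<open>The coefficient condition, cleared of its denominator and restated for points of
    the circle instead of angles.\<close>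
  have coeff: "summable (\<lambda>n. norm (?c \<zeta> n)) \<and> (\<Sum>n. norm (?c \<zeta> n)) < norm (sinh \<zeta>)"
    if "norm \<zeta> = 1" for \<zeta>
  proof -
    obtain \<theta> where \<theta>: "0 \<le> \<theta>" "\<theta> < 2 * pi" "\<zeta> = Complex (cos \<theta>) (sin \<theta>)"
      using complex_unimodular_polar[OF \<open>norm \<zeta> = 1\<close>] .
    then have "\<zeta> = exp (\<i> * of_real \<theta>)"
      by (simp add: cis.code flip: cis_conv_exp)
    then have *: "summable (\<lambda>n. norm (?c \<zeta> n) / norm (sinh \<zeta>))"
      "(\<Sum>n. norm (?c \<zeta> n) / norm (sinh \<zeta>)) < 1"
      using assms(3)[of \<theta>] \<theta>(1,2) by (simp_all add: norm_mult norm_divide)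
    have "summable (\<lambda>n. norm (?c \<zeta> n))"
      using *(1) sinh_nz[OF that] by (subst (asm) summable_divide_iff) auto
    then show ?thesis
      using *(2) sinh_nz[OF that] by (simp add: suminf_divide divide_less_eq)
  qed
  have exp_f: "(\<lambda>n. a (n + 2) * z ^ (n + 2)) sums (f z - 1 * z)" if "z \<in> unit_disc" for z
    using assms(2) that by (simp add: normalized_expansion_def)

  have fnz: "f z \<noteq> 0" if "z \<in> unit_disc" "z \<noteq> 0" for z
  proof -
    \<comment> \<open>At \<open>\<zeta> = \<i>\<close> the value \<open>sinh \<zeta> = \<i> sin 1\<close> is imaginary, so every weight is at least 1.\<close>
    have s: "sinh \<i> = \<i> * complex_of_real (sin 1)"
      using sin_of_real[of 1] by (simp add: sinh_conv_sin)
    define r where "r = norm (sinh \<i>)"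
    have r: "r > 0"
      using sinh_nz[of \<i>] by (simp add: r_def)
    have ge: "norm (r * a (n + 2)) \<le> norm (?c \<i> n)" for n
    proof -
      have "r \<le> norm (of_nat (n + 2) - (1 + sinh \<i>))"
        using abs_Im_le_cmod[of "of_nat (n + 2) - (1 + sinh \<i>)"]
        by (simp add: r_def s norm_mult)
      then show ?thesis
        using r by (simp add: norm_mult mult_right_mono)
    qed
    have sm: "summable (\<lambda>n. norm (r * a (n + 2)))"
      by (rule summable_comparison_test'[of "\<lambda>n. norm (?c \<i> n)" 0])
        (use coeff[of \<i>] ge in simp_all)
    have "(\<Sum>n. norm (r * a (n + 2))) < norm (of_real r :: complex)"
      using suminf_le[OF ge sm] coeff[of \<i>] unfolding r_def by fastforce
    \<comment> \<open>Scaling \<open>f\<close> by \<open>r\<close> makes its linear coefficient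
      \<open>r\<close>, which exceeds the sum of the other scaled coefficients.\<close>
    moreover have "(\<lambda>n. (r * a (n + 2)) * z ^ (n + 2)) sums (r * f z - r * z)"
      using sums_mult[OF exp_f[OF that(1)], of "of_real r"] by (simp add: algebra_simps)
    ultimately have "r * f z \<noteq> 0"
      using dominated_power_series_nonzero[OF sm] that by blast
    then show ?thesis
      by simp
  qed

  let ?q = "starlike_quotient f"
  have hol: "f holomorphic_on unit_disc"
    using assms(1) by (simp add: class_A_def analytic_imp_holomorphic)
  have "(\<lambda>z. z * deriv f z / f z) holomorphic_on unit_disc - {0}"
    using fnz hol
    by (intro holomorphic_intros holomorphic_on_subset[OF holomorphic_deriv[OF hol]]
          holomorphic_on_subset[OF hol]) auto
  then have q': "?q holomorphic_on unit_disc - {0}"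
    by (rule holomorphic_transform) (auto simp: starlike_quotient_def)
  \<comment> \<open>Continuity at the origin is what makes the isolated singularity there
    removable.\<close>
  have "isCont ?q z" if "z \<in> unit_disc" for z
  proof (cases "z = 0")
    case True
    then show ?thesis
      using starlike_quotient_tendsto[OF assms(1)] by (simp add: isCont_def)
  next
    case False
    then show ?thesis
      using q' that holomorphic_on_imp_continuous_on[OF q']
      by (subst (asm) continuous_on_eq_continuous_at) auto
  qed
  then have "?q holomorphic_on unit_disc"
    by (intro no_isolated_singularity[OF _ q'] continuous_at_imp_continuous_on) auto
  then have p: "(\<lambda>z. ?q z - 1) holomorphic_on unit_disc"
    by (intro holomorphic_intros)

  have omits: "?q z - 1 \<noteq> sinh \<zeta>" if z: "z \<in> unit_disc" and "norm \<zeta> = 1" for z \<zeta>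
  proof (cases "z = 0")
    case True
    then show ?thesis
      using sinh_nz[OF \<open>norm \<zeta> = 1\<close>] by (simp add: starlike_quotient_def)
  next
    case False
    have "(\<lambda>n. of_nat (n + 2) * a (n + 2) * z ^ (n + 2) - (1 + sinh \<zeta>) * (a (n + 2) * z ^ (n + 2)))
        sums (z * deriv f z - z - (1 + sinh \<zeta>) * (f z - 1 * z))"
      by (intro sums_diff sums_mult exp_f normalized_expansion_deriv assms(2) z)
    \<comment> \<open>The linear coefficient is
      \<open>1 - (1 + sinh \<zeta>) = - sinh \<zeta>\<close>, whose norm is the bound in
      \<open>coeff\<close>.\<close>
    then have "(\<lambda>n. ?c \<zeta> n * z ^ (n + 2)) sums (z * deriv f z - (1 + sinh \<zeta>) * f z - (- sinh \<zeta>) * z)"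
      by (simp add: algebra_simps)
    then have "z * deriv f z - (1 + sinh \<zeta>) * f z \<noteq> 0"
      using coeff[OF \<open>norm \<zeta> = 1\<close>] z False
      by (elim dominated_power_series_nonzero[rotated -1]) simp_all
    then show ?thesis
      using False fnz[OF z False] by (auto simp: starlike_quotient_def field_simps)
  qed
  have "(\<lambda>z. ?q z - 1) \<prec>\<^sub>D sinh"
  proof (rule subordinateI_omits_boundary[OF p])
    show "sinh holomorphic_on unit_disc"
      unfolding sinh_field_def by (intro holomorphic_intros) auto
    show "inj_on sinh unit_disc"
      using inj_on_sinh_cball ball_subset_cball by (rule inj_on_subset)
    show "continuous_on (cball 0 1) (sinh :: complex \<Rightarrow> complex)"
      by (intro continuous_intros)
    show "?q z - 1 \<noteq> sinh \<zeta>" if "z \<in> unit_disc" "\<zeta> \<in> sphere 0 1" for z \<zeta>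
      using that by (intro omits) auto
  qed (simp add: starlike_quotient_def)
  then show ?thesis
    using assms(1) fnz by (simp add: G_sh_def)
qed

end
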